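(* For complex $a,\beta,c,x$, $$\sum_{n=0}^{\infty}\frac{\Gamma(a+1)\,\bigl(x(cx+1)^{-\beta}\bigr)^n\;{}_2F_1(-n,-n\beta;\,a-n+1;\,c)}{n!\,\Gamma(a-n+1)}=-\frac{(x+1)^a(cx+1)}{\beta cx-cx-1}.$$
   Context: $\Gamma$ is the Euler gamma function and ${}_2F_1(a,b;c;z)=\sum_{k\ge0}\frac{(a)_k(b)_k}{(c)_k\,k!}z^k$ is the Gauss hypergeometric function, with $(a)_k=a(a+1)\cdots(a+k-1)$.
   Formalization: The series can diverge, so the identity is shown for x near 0 and on any connected open set around 0 where it converges and x+1, cx+1 avoid the nonpositive reals; powers are principal, and for integer a the terms, which may be undefined, are read as limits in a. *)

theory Defs
  imports "HOL-Analysis.Analysis"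
begin

definition hyp2F1 :: "complex \<Rightarrow> complex \<Rightarrow> complex \<Rightarrow> complex \<Rightarrow> complex" where
  "hyp2F1 a b c z =
     (\<Sum>k. pochhammer a k * pochhammer b k / (pochhammer c k * fact k) * z ^ k)"

definition generic_coeff :: "complex \<Rightarrow> complex \<Rightarrow> complex \<Rightarrow> nat \<Rightarrow> complex" where
  "generic_coeff a \<beta> c n =
     Gamma (a + 1) * hyp2F1 (- of_nat n) (- (of_nat n * \<beta>)) (a - of_nat n + 1) c
       / (fact n * Gamma (a - of_nat n + 1))"

text \<open>
  For integer \<open>a\<close> the expression above is undefined for some \<open>n\<close> (poles of the gamma
  function, or zero denominators in the hypergeometric series before it terminates), and
  HOL's total functions would return arbitrary values there.  As a function of \<open>a\<close> it
  has only removable singularities: off the integers it is equal to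
  \<open>\<Sum>k\<le>n. (a gchoose (n - k)) * ((n * \<beta>) gchoose k) * c ^ k\<close>, a polynomial in \<open>a\<close>.
  At integers it is read as the limit.
\<close>

definition summand_coeff :: "complex \<Rightarrow> complex \<Rightarrow> complex \<Rightarrow> nat \<Rightarrow> complex" where
  "summand_coeff a \<beta> c n =
     (if a \<in> \<int> then Lim (at a) (\<lambda>\<alpha>. generic_coeff \<alpha> \<beta> c n) else generic_coeff a \<beta> c n)"

text \<open>Complex powers are principal branches (\<open>powr\<close>).\<close>

definition summand :: "complex \<Rightarrow> complex \<Rightarrow> complex \<Rightarrow> complex \<Rightarrow> nat \<Rightarrow> complex" where
  "summand a \<beta> c x n = summand_coeff a \<beta> c n * (x * (c * x + 1) powr (- \<beta>)) ^ n"

end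

theory Submission
  imports Defs "HOL-Complex_Analysis.Complex_Analysis"
begin

text \<open>
  Put \<open>\<phi>(t) = (1 + ct) powr \<beta>\<close>, \<open>H(t) = (1 + t) powr a\<close> and
  \<open>g(x) = x / \<phi>(x)\<close>.  The \<open>n\<close>-th coefficient of the series is the \<open>n\<close>-th Taylor coefficient of
  \<open>H \<phi>\<^sup>n\<close> at \<open>0\<close>, so near \<open>x = 0\<close> the identity is the Lagrange-Buermann formula at \<open>w = g(x)\<close>:
  writing the coefficients as Cauchy integrals and summing the geometric series gives the
  integral of \<open>H(t) / (t - w \<phi>(t))\<close>, whose only pole inside the circle is the simple one at
  \<open>t = x\<close>.

  On a connected \<open>U\<close> where the series converges, \<open>g\<close> is an open map, so \<open>g(U)\<close> lies in the open
  disc of convergence and the sum is holomorphic on \<open>U\<close>.  The identity multiplied by its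
  denominator then extends from \<open>0\<close> to \<open>U\<close>, and the denominator cannot vanish because
  \<open>H(x) (1 + cx)\<close> does not.
\<close>

section \<open>The coefficients as binomial sums and as Taylor coefficients\<close>

text \<open>The upper parameter -n stops the hypergeometric series at k = n. Off the integers all
  gamma values involved are finite and nonzero, so the gamma factor in (a-n+1)_k cancels
  Gamma(a-n+1), leaving Gamma(a+1) / Gamma(a-n+k+1).\<close>

lemma generic_coeff_eq_sum:
  assumes "a \<notin> \<int>"
  shows "generic_coeff a \<beta> c n =
           (\<Sum>k\<le>n. (a gchoose (n - k)) * ((of_nat n * \<beta>) gchoose k) * c ^ k)"
proof -
  have shift: "a + of_int m \<notin> \<int>" for m
    using assms Ints_diff[of "a + of_int m" "of_int m"] by auto
  have nonpos: "z \<notin> \<int>\<^sub>\<le>\<^sub>0" if "z \<notin> \<int>" for z :: complex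
    using that nonpos_Ints_Int by auto
  have a1: "a + 1 \<notin> \<int>\<^sub>\<le>\<^sub>0"
    using nonpos[OF shift[of 1]] by simp
  have an: "a - of_nat n + 1 \<notin> \<int>\<^sub>\<le>\<^sub>0"
    using nonpos[OF shift[of "1 - int n"]] by (simp add: algebra_simps)
  let ?A = "Gamma (a + 1) / (fact n * Gamma (a - of_nat n + 1))"
  let ?T = "\<lambda>k. pochhammer (- of_nat n) k * pochhammer (- (of_nat n * \<beta>)) k
                  / (pochhammer (a - of_nat n + 1) k * fact k) * c ^ k"
  have "hyp2F1 (- of_nat n) (- (of_nat n * \<beta>)) (a - of_nat n + 1) c = (\<Sum>k\<le>n. ?T k)"
    unfolding hyp2F1_def
    by (rule suminf_finite) (auto simp: pochhammer_of_nat_eq_0_lemma)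
  hence "generic_coeff a \<beta> c n = (\<Sum>k\<le>n. ?A * ?T k)"
    by (simp add: generic_coeff_def sum_distrib_left sum_divide_distrib mult_ac)
  also have "\<dots> = (\<Sum>k\<le>n. (a gchoose (n - k)) * ((of_nat n * \<beta>) gchoose k) * c ^ k)"
  proof (rule sum.cong[OF refl])
    fix k assume "k \<in> {..n}"
    hence k: "k \<le> n" by simp
    have ank: "a - of_nat n + 1 + of_nat k \<notin> \<int>\<^sub>\<le>\<^sub>0"
      using nonpos[OF shift[of "1 - int n + int k"]] by (simp add: algebra_simps)
    have nz: "Gamma (a - of_nat n + 1) \<noteq> 0" "Gamma (a - of_nat n + 1 + of_nat k) \<noteq> 0"
      using an ank by (auto simp: Gamma_eq_zero_iff)
    have g1: "(a gchoose (n - k)) =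
                Gamma (a + 1) / (fact (n - k) * Gamma (a - of_nat n + 1 + of_nat k))"
      using k by (simp add: gbinomial_Gamma[OF a1] of_nat_diff algebra_simps)
    have g2: "((of_nat n * \<beta>) gchoose k) = (- 1) ^ k * pochhammer (- (of_nat n * \<beta>)) k / fact k"
      by (rule gbinomial_pochhammer)
    have g3: "pochhammer (a - of_nat n + 1) k =
                Gamma (a - of_nat n + 1 + of_nat k) / Gamma (a - of_nat n + 1)"
      by (rule pochhammer_Gamma[OF an])
    \<comment> \<open>The factor (-n)_k supplies the sign required by \<open>g2\<close> and turns
      the prefactor 1/n! into the 1/(n-k)! of \<open>g1\<close>.\<close>
    have "fact k * of_nat (n choose k) = (- 1) ^ k * pochhammer (- of_nat n :: complex) k"
      by (simp add: binomial_gbinomial gbinomial_pochhammer)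
    hence "(- 1) ^ k * (fact k * of_nat (n choose k)) = pochhammer (- of_nat n :: complex) k"
      by (simp add: mult.assoc[symmetric] power_mult_distrib[symmetric])
    hence g4: "pochhammer (- of_nat n :: complex) k = (- 1) ^ k * (fact n / fact (n - k))"
      using k by (simp add: binomial_fact field_simps)
    show "?A * ?T k = (a gchoose (n - k)) * ((of_nat n * \<beta>) gchoose k) * c ^ k"
      unfolding g1 g2 g3 g4 using nz by (simp add: field_simps)
  qed
  finally show ?thesis .
qed

lemma summand_coeff_eq_sum:
  "summand_coeff a \<beta> c n =
     (\<Sum>k\<le>n. (a gchoose (n - k)) * ((of_nat n * \<beta>) gchoose k) * c ^ k)"
proof (cases "a \<in> \<int>")
  case True
  let ?P = "\<lambda>a. \<Sum>k\<le>n. (a gchoose (n - k)) * ((of_nat n * \<beta>) gchoose k) * c ^ k"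
  have "isCont ?P a"
    unfolding gbinomial_prod_rev by (intro continuous_intros) auto
  hence "?P \<midarrow>a\<rightarrow> ?P a"
    by (simp add: isCont_def)
  \<comment> \<open>The integers other than a form a closed set, so a punctured neighbourhood of a
    contains no integer and the non-integer formula determines the limit.\<close>
  moreover have "\<forall>\<^sub>F \<alpha> in at a. \<alpha> \<in> - (\<int> - {a})"
  proof (rule eventually_at_in_open')
    show "open (- (\<int> - {a}))"
      by (intro open_Compl closed_subset_Ints) auto
  qed auto
  hence "\<forall>\<^sub>F \<alpha> in at a. generic_coeff \<alpha> \<beta> c n = ?P \<alpha>"
    using eventually_neq_at_within[of a a UNIV]
    by eventually_elim (auto intro!: generic_coeff_eq_sum)
  ultimately have "(\<lambda>\<alpha>. generic_coeff \<alpha> \<beta> c n) \<midarrow>a\<rightarrow> ?P a"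
    using tendsto_cong by fast
  hence "Lim (at a) (\<lambda>\<alpha>. generic_coeff \<alpha> \<beta> c n) = ?P a"
    by (intro tendsto_Lim) auto
  with True show ?thesis
    by (simp add: summand_coeff_def)
qed (simp add: summand_coeff_def generic_coeff_eq_sum)

lemma has_fps_expansion_binomial_linear:
  fixes b c :: complex
  shows "(\<lambda>t. (1 + c * t) powr b) has_fps_expansion Abs_fps (\<lambda>k. (b gchoose k) * c ^ k)"
proof (rule has_fps_expansionI)
  have "\<forall>\<^sub>F t in nhds 0. t \<in> {t. norm (c * t) < 1}"
    by (intro eventually_nhds_in_open open_Collect_less continuous_intros) auto
  thus "\<forall>\<^sub>F t in nhds 0. (\<lambda>n. fps_nth (Abs_fps (\<lambda>k. (b gchoose k) * c ^ k)) n * t ^ n)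
          sums (1 + c * t) powr b"
  proof eventually_elim
    case (elim t)
    thus ?case
      using gen_binomial_complex[of "c * t" b] by (simp add: power_mult_distrib mult_ac)
  qed
qed

text \<open>Both sides are exp(n b Ln z), so no branch ambiguity arises. At z = 0, n = 0 the
  equation fails: \<open>0 powr 0 = 0\<close>, whereas a zeroth power is 1.\<close>

lemma powr_nat_mult: "z powr (of_nat n * b) = (z powr b) ^ n" if "z \<noteq> 0" for z b :: complex
  using that by (simp add: powr_def exp_of_nat_mult mult.assoc)

text \<open>The binomial sum is a Cauchy product: the coefficient of t^n in (1+ct)^(n \<beta>)
  (1+t)^a. This is the form that Lagrange-Buermann inversion needs.\<close>

lemma summand_coeff_eq_deriv:
  assumes "R > 0" "\<And>t. norm t < R \<Longrightarrow> 1 + c * t \<noteq> 0"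
  shows "summand_coeff a \<beta> c n =
           (deriv ^^ n) (\<lambda>t. (1 + t) powr a * ((1 + c * t) powr \<beta>) ^ n) 0 / fact n"
proof -
  let ?G = "Abs_fps (\<lambda>k. ((of_nat n * \<beta>) gchoose k) * c ^ k)"
  have "(\<lambda>t. (1 + c * t) powr (of_nat n * \<beta>) * (1 + t) powr a)
          has_fps_expansion ?G * fps_binomial a"
    by (intro fps_expansion_intros has_fps_expansion_binomial_linear)
  moreover have "\<forall>\<^sub>F t in nhds 0. (1 + c * t) powr (of_nat n * \<beta>) * (1 + t) powr a =
                   (1 + t) powr a * ((1 + c * t) powr \<beta>) ^ n"
    using eventually_nhds_in_open[of "ball 0 R" 0] assms
    by (auto elim!: eventually_mono simp: powr_nat_mult)
  ultimately have "(\<lambda>t. (1 + t) powr a * ((1 + c * t) powr \<beta>) ^ n)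
          has_fps_expansion ?G * fps_binomial a"
    using has_fps_expansion_cong by fast
  moreover have "summand_coeff a \<beta> c n = fps_nth (?G * fps_binomial a) n"
    unfolding summand_coeff_eq_sum fps_mult_nth by (simp add: atMost_atLeast0 mult_ac)
  ultimately show ?thesis
    by (simp add: fps_nth_fps_expansion)
qed

section \<open>Lagrange-Buermann formula\<close>

text \<open>Starting from x and setting w = x / \<phi>(x) avoids constructing an inverse function.
  That x is the only zero of t - w \<phi>(t) follows from a Lipschitz estimate instead of Rouche's
  theorem.\<close>

lemma Lagrange_Buermann:
  fixes H \<phi> :: "complex \<Rightarrow> complex"
  assumes R: "R > 0" and H: "H holomorphic_on ball 0 R" and \<phi>: "\<phi> holomorphic_on ball 0 R"
    and \<phi>0: "\<phi> 0 \<noteq> 0"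
  obtains r where "0 < r" "r < R"
    "\<And>x. norm x < r \<Longrightarrow> \<phi> x \<noteq> 0 \<and> \<phi> x - x * deriv \<phi> x \<noteq> 0 \<and>
       (\<lambda>n. (deriv ^^ n) (\<lambda>t. H t * \<phi> t ^ n) 0 / fact n * (x / \<phi> x) ^ n)
         sums (H x * \<phi> x / (\<phi> x - x * deriv \<phi> x))"
proof -
  \<comment> \<open>Halving the radius gives a compact disc inside the domain, on which \<phi>, its
    derivative and H are bounded.\<close>
  define \<rho> where "\<rho> = R / 2"
  have \<rho>: "\<rho> > 0" and sub: "cball 0 \<rho> \<subseteq> ball (0::complex) R"
    using R by (auto simp: \<rho>_def)
  have d\<phi>: "deriv \<phi> holomorphic_on ball 0 R"
    using \<phi> by (intro holomorphic_deriv) auto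
  have bnd: "\<exists>B>0. \<forall>t\<in>cball 0 \<rho>. norm (f t) \<le> B" if "f holomorphic_on ball 0 R" for f :: "complex \<Rightarrow> complex"
  proof -
    have "continuous_on (cball 0 \<rho>) f"
      using holomorphic_on_imp_continuous_on[OF that] sub by (rule continuous_on_subset)
    hence "bounded (f ` cball 0 \<rho>)"
      by (intro compact_imp_bounded compact_continuous_image) auto
    thus ?thesis
      by (auto simp: bounded_pos)
  qed
  obtain M where M: "M > 0" "\<And>t. t \<in> cball 0 \<rho> \<Longrightarrow> norm (\<phi> t) \<le> M"
    using bnd[OF \<phi>] by blast
  obtain L where L: "L > 0" "\<And>t. t \<in> cball 0 \<rho> \<Longrightarrow> norm (deriv \<phi> t) \<le> L"
    using bnd[OF d\<phi>] by blast
  obtain K where K: "K > 0" "\<And>t. t \<in> cball 0 \<rho> \<Longrightarrow> norm (H t) \<le> K"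
    using bnd[OF H] by blast
  have lip: "norm (\<phi> s - \<phi> t) \<le> L * norm (s - t)" if "s \<in> cball 0 \<rho>" "t \<in> cball 0 \<rho>" for s t
  proof (rule field_differentiable_bound[where S = "cball 0 \<rho>" and f' = "deriv \<phi>"])
    show "(\<phi> has_field_derivative deriv \<phi> z) (at z within cball 0 \<rho>)" if "z \<in> cball 0 \<rho>" for z
      using holomorphic_derivI[OF \<phi>, of z] that sub has_field_derivative_at_within by blast
  qed (use that L in auto)

  have c0: "isCont \<phi> 0"
    using \<phi> R by (meson centre_in_ball continuous_on_eq_continuous_at holomorphic_on_imp_continuous_on open_ball)
  have "\<phi> \<midarrow>0\<rightarrow> \<phi> 0"
    using c0 by (simp add: isCont_def)
  moreover have "(\<lambda>x. x / \<phi> x) \<midarrow>0\<rightarrow> 0 / \<phi> 0"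
    by (intro tendsto_intros) (use c0 \<phi>0 in \<open>auto simp: isCont_def\<close>)
  \<comment> \<open>The bound \<rho>/(2M) on |w| makes the geometric ratio w \<phi>(t)/t at most 1/2
    on the circle. The bound 1/(2L) makes w \<phi> a contraction with constant 1/2.\<close>
  ultimately have "\<forall>\<^sub>F x in nhds 0. \<phi> x \<noteq> 0 \<and> norm (x / \<phi> x) < min (\<rho> / (2 * M)) (1 / (2 * L))"
    unfolding eventually_nhds_conv_at
    using \<phi>0 \<rho> M(1) L(1)
    by (auto intro!: eventually_conj tendsto_imp_eventually_ne order_tendstoD(2)[of _ 0] tendsto_norm_zero)
  then obtain r0 where r0: "r0 > 0"
      "\<And>x. norm x < r0 \<Longrightarrow> \<phi> x \<noteq> 0 \<and> norm (x / \<phi> x) < min (\<rho> / (2 * M)) (1 / (2 * L))"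
    unfolding eventually_nhds_metric by auto
  define r where "r = min r0 \<rho>"
  show thesis
  proof (rule that[of r])
    show "0 < r" "r < R"
      using r0(1) \<rho> R by (auto simp: r_def \<rho>_def)
    fix x :: complex
    assume "norm x < r"
    hence x: "norm x < \<rho>" "norm x < r0"
      by (auto simp: r_def)
    define w where "w = x / \<phi> x"
    have \<phi>x: "\<phi> x \<noteq> 0" and wM: "norm w * M \<le> \<rho> / 2" and wL: "norm w * L \<le> 1 / 2"
      using r0(2)[OF x(2)] M(1) L(1) by (auto simp: w_def field_simps)
    have wx: "w * \<phi> x = x"
      using \<phi>x by (simp add: w_def)
    define D where "D = (\<lambda>t. t - w * \<phi> t)"
    have Dx: "D x = 0"
      by (simp add: D_def wx)
    have holD: "D holomorphic_on ball 0 R"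
      unfolding D_def by (intro holomorphic_intros \<phi>)
    \<comment> \<open>As D(x) = 0, D(t) is t - x minus a term of at most half its size, so D has no
      other zero in the disc.\<close>
    have D_lower: "norm (t - x) / 2 \<le> norm (D t)" if "t \<in> cball 0 \<rho>" for t
    proof -
      have "norm (w * (\<phi> t - \<phi> x)) \<le> norm w * (L * norm (t - x))"
        unfolding norm_mult using lip[of t x] that x by (intro mult_left_mono) auto
      also have "\<dots> \<le> 1 / 2 * norm (t - x)"
        using mult_right_mono[OF wL, of "norm (t - x)"] by simp
      finally have "norm (w * (\<phi> t - \<phi> x)) \<le> 1 / 2 * norm (t - x)" .
      moreover have "D t = (t - x) - w * (\<phi> t - \<phi> x)"
        by (simp add: D_def algebra_simps wx)
      ultimately show ?thesis
        using norm_triangle_ineq2[of "t - x" "w * (\<phi> t - \<phi> x)"] by simp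
    qed
    have xR: "x \<in> ball 0 R" and xc: "x \<in> cball 0 \<rho>"
      using x R by (auto simp: \<rho>_def)
    have derivD: "deriv D x = 1 - w * deriv \<phi> x"
      unfolding D_def
      by (rule DERIV_imp_deriv) (auto intro!: derivative_eq_intros holomorphic_derivI[OF \<phi>] xR)
    have "norm (w * deriv \<phi> x) \<le> 1 / 2"
      using mult_left_mono[OF L(2)[OF xc], of "norm w"] wL by (simp add: norm_mult)
    hence derivD_nz: "deriv D x \<noteq> 0"
      unfolding derivD using norm_triangle_ineq2[of 1 "w * deriv \<phi> x"] by auto
    \<comment> \<open>Dividing out the simple zero gives H/D = (H/q)/(t-x) with H/q holomorphic, so
      Cauchy's formula at x does the work of the residue theorem.\<close>
    define q where "q = (\<lambda>t. if t = x then deriv D x else (D t - D x) / (t - x))"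
    have holq: "q holomorphic_on ball 0 R"
      unfolding q_def by (intro pole_lemma_open holD) auto
    have q_nz: "q t \<noteq> 0" if "t \<in> cball 0 \<rho>" for t
      using D_lower[OF that] derivD_nz Dx by (auto simp: q_def)
    have holHq: "(\<lambda>t. H t / q t) holomorphic_on cball 0 \<rho>"
      using holomorphic_on_subset[OF H sub] holomorphic_on_subset[OF holq sub] q_nz
      by (intro holomorphic_on_divide) auto
    have "((\<lambda>t. H t / q t / (t - x)) has_contour_integral (2 * of_real pi * \<i> * (H x / q x)))
            (circlepath 0 \<rho>)"
      by (intro Cauchy_integral_circlepath holomorphic_on_imp_continuous_on[OF holHq]
                holomorphic_on_subset[OF holHq]) (use x in auto)
    hence int: "((\<lambda>t. H t / D t) has_contour_integral (2 * of_real pi * \<i> * (H x / q x))) (circlepath 0 \<rho>)"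
      by (rule has_contour_integral_eq) (use x \<rho> Dx in \<open>auto simp: q_def\<close>)

    \<comment> \<open>Up to the factor w^n this is the Cauchy integrand for the n-th derivative at
      0. It also equals (H/t)(w \<phi>/t)^n, whose sum over n is H/D.\<close>
    define T where "T = (\<lambda>n t. w ^ n * (H t * \<phi> t ^ n / (t - 0) ^ Suc n))"
    define C where "C = (\<lambda>n. (deriv ^^ n) (\<lambda>t. H t * \<phi> t ^ n) 0 / fact n)"
    have T_int: "(T n has_contour_integral 2 * of_real pi * \<i> * (C n * w ^ n)) (circlepath 0 \<rho>)" for n
    proof -
      have hol: "(\<lambda>t. H t * \<phi> t ^ n) holomorphic_on cball 0 \<rho>"
        using holomorphic_on_subset[OF H sub] holomorphic_on_subset[OF \<phi> sub]
        by (intro holomorphic_intros)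
      have "((\<lambda>t. H t * \<phi> t ^ n / (t - 0) ^ Suc n) has_contour_integral
              2 * pi * \<i> / fact n * (deriv ^^ n) (\<lambda>t. H t * \<phi> t ^ n) 0) (circlepath 0 \<rho>)"
        by (intro Cauchy_has_contour_integral_higher_derivative_circlepath
                  holomorphic_on_imp_continuous_on[OF hol] holomorphic_on_subset[OF hol])
           (use \<rho> in auto)
      from has_contour_integral_lmul[OF this, of "w ^ n"] show ?thesis
        by (simp add: T_def C_def mult_ac)
    qed
    have ratio: "norm (w * \<phi> t / t) \<le> 1 / 2" if "t \<in> sphere 0 \<rho>" for t
      using mult_left_mono[OF M(2)[of t], of "norm w"] wM \<rho> that
      by (auto simp: norm_mult norm_divide divide_simps)
    have T_alt: "T n t = H t / t * (w * \<phi> t / t) ^ n" for n t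
      by (simp add: T_def power_mult_distrib power_divide)
    have T_sums: "(\<lambda>n. T n t) sums (H t / D t)" if "t \<in> sphere 0 \<rho>" for t
    proof -
      have t: "t \<noteq> 0" using that \<rho> by auto
      have "(\<lambda>n. H t / t * (w * \<phi> t / t) ^ n) sums (H t / t * (1 / (1 - w * \<phi> t / t)))"
        using ratio[OF that] by (intro sums_mult geometric_sums) simp
      also have "H t / t * (1 / (1 - w * \<phi> t / t)) = H t / D t"
        using t by (simp add: D_def divide_simps)
      finally show ?thesis
        by (simp add: T_alt)
    qed
    \<comment> \<open>Uniform convergence on the circle justifies integrating the series term by
      term.\<close>
    have "uniform_limit (sphere 0 \<rho>) (\<lambda>N t. \<Sum>n<N. T n t) (\<lambda>t. \<Sum>n. T n t) sequentially"
    proof (rule Weierstrass_m_test)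
      show "norm (T n t) \<le> K / \<rho> * (1 / 2) ^ n" if "t \<in> sphere 0 \<rho>" for n t
        unfolding T_alt norm_mult norm_power
        using ratio[OF that] K(2)[of t] K(1) \<rho> that
        by (intro mult_mono power_mono) (auto simp: norm_divide intro: divide_right_mono)
    qed (intro summable_mult summable_geometric, simp)
    hence unif: "uniform_limit (sphere 0 \<rho>) (\<lambda>N t. \<Sum>n<N. T n t) (\<lambda>t. H t / D t) sequentially"
      by (rule uniform_limit_cong'[THEN iffD1, rotated -1]) (use T_sums in \<open>auto simp: sums_iff\<close>)
    have part: "((\<lambda>t. \<Sum>n<N. T n t) has_contour_integral
                   (\<Sum>n<N. 2 * of_real pi * \<i> * (C n * w ^ n))) (circlepath 0 \<rho>)" for N
      by (intro has_contour_integral_sum T_int) auto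
    have "(\<lambda>N. contour_integral (circlepath 0 \<rho>) (\<lambda>t. \<Sum>n<N. T n t))
            \<longlonglongrightarrow> contour_integral (circlepath 0 \<rho>) (\<lambda>t. H t / D t)"
      by (rule contour_integral_uniform_limit_circlepath)
         (use part unif \<rho> in \<open>auto intro!: always_eventually has_contour_integral_integrable\<close>)
    hence "(\<lambda>n. 2 * of_real pi * \<i> * (C n * w ^ n)) sums (2 * of_real pi * \<i> * (H x / q x))"
      by (simp only: contour_integral_unique[OF part] contour_integral_unique[OF int] sums_def)
    hence sums: "(\<lambda>n. C n * w ^ n) sums (H x / q x)"
      by (subst (asm) sums_mult_iff) auto
    \<comment> \<open>Here q(x) = D'(x) = 1 - w \<phi>'(x) and w \<phi>(x) = x.\<close>
    have eq: "\<phi> x - x * deriv \<phi> x = \<phi> x * q x"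
      using \<phi>x by (simp add: q_def derivD w_def field_simps)
    have "\<phi> x - x * deriv \<phi> x \<noteq> 0"
      unfolding eq using \<phi>x q_nz[OF xc] by simp
    moreover have "H x / q x = H x * \<phi> x / (\<phi> x - x * deriv \<phi> x)"
      unfolding eq using \<phi>x by simp
    ultimately
    show "\<phi> x \<noteq> 0 \<and> \<phi> x - x * deriv \<phi> x \<noteq> 0 \<and>
       (\<lambda>n. (deriv ^^ n) (\<lambda>t. H t * \<phi> t ^ n) 0 / fact n * (x / \<phi> x) ^ n)
         sums (H x * \<phi> x / (\<phi> x - x * deriv \<phi> x))"
      using sums \<phi>x unfolding C_def w_def by metis
  qed
qed


section \<open>The identity near the origin\<close>

lemma summand_sums_near_0:
  obtains r where "r > 0"
    "\<And>x. norm x < r \<Longrightarrow> \<beta> * c * x - c * x - 1 \<noteq> 0 \<and>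
       summand a \<beta> c x sums (- ((x + 1) powr a * (c * x + 1) / (\<beta> * c * x - c * x - 1)))"
proof -
  \<comment> \<open>This gives R \<le> 1 and |c| R < 1 even for c = 0, so 1+t and 1+ct stay in the
    right half-plane, off the branch cut.\<close>
  define R where "R = 1 / (1 + norm c)"
  have R: "R > 0" "R \<le> 1"
    using norm_ge_zero[of c] by (auto simp: R_def divide_simps add_pos_nonneg)
  have small: "norm (c * t) < 1" if "norm t < R" for t
  proof -
    have "norm (c * t) \<le> (1 + norm c) * norm t"
      unfolding norm_mult by (intro mult_right_mono) auto
    also have "\<dots> < 1"
      using that norm_ge_zero[of c] by (simp add: R_def field_simps)
    finally show ?thesis .
  qed
  have slit: "1 + z \<notin> \<real>\<^sub>\<le>\<^sub>0" if "norm z < 1" for z :: complex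
    using that abs_Re_le_cmod[of z] by (auto simp: complex_nonpos_Reals_iff)
  have slit1: "1 + t \<notin> \<real>\<^sub>\<le>\<^sub>0" and slitc: "1 + c * t \<notin> \<real>\<^sub>\<le>\<^sub>0" if "norm t < R" for t
    using slit[of t] slit[OF small[OF that]] that R by auto
  have nz: "1 + c * t \<noteq> 0" if "norm t < R" for t
    using slitc[OF that] by auto
  let ?H = "\<lambda>t. (1 + t) powr a" and ?\<phi> = "\<lambda>t. (1 + c * t) powr \<beta>"
  have H: "?H holomorphic_on ball 0 R" and \<phi>: "?\<phi> holomorphic_on ball 0 R"
    using slit1 slitc by (auto intro!: holomorphic_intros)
  have \<phi>': "deriv ?\<phi> t = \<beta> * c * ?\<phi> t / (1 + c * t)" if "norm t < R" for t
  proof -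
    have "(?\<phi> has_field_derivative \<beta> * (1 + c * t) powr (\<beta> - 1) * c) (at t)"
      by (rule DERIV_chain2[where f = "\<lambda>z. z powr \<beta>" and g = "\<lambda>t. 1 + c * t",
                OF has_field_derivative_powr[OF slitc[OF that]]])
         (auto intro!: derivative_eq_intros)
    thus ?thesis
      using nz[OF that] by (simp add: DERIV_imp_deriv powr_diff mult_ac)
  qed
  have \<phi>0: "?\<phi> 0 \<noteq> 0" by simp
  obtain r where r: "0 < r" "r < R"
    and sums: "\<And>x. norm x < r \<Longrightarrow> ?\<phi> x \<noteq> 0 \<and> ?\<phi> x - x * deriv ?\<phi> x \<noteq> 0 \<and>
       (\<lambda>n. (deriv ^^ n) (\<lambda>t. ?H t * ?\<phi> t ^ n) 0 / fact n * (x / ?\<phi> x) ^ n)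
         sums (?H x * ?\<phi> x / (?\<phi> x - x * deriv ?\<phi> x))"
    by (rule Lagrange_Buermann[OF R(1) H \<phi> \<phi>0]) (rule that)
  show thesis
  proof (rule that[OF r(1)])
    fix x :: complex assume x: "norm x < r"
    let ?d = "\<beta> * c * x - c * x - 1"
    have xR: "norm x < R" using x r by simp
    have \<phi>x: "?\<phi> x \<noteq> 0" using sums[OF x] by simp
    \<comment> \<open>By \<open>\<phi>'\<close> the left side is \<phi>(x) (1 - \<beta>cx/(1+cx)),
      so the factor \<phi>(x) cancels from the closed form.\<close>
    have den: "?\<phi> x - x * deriv ?\<phi> x = ?\<phi> x * (- ?d / (1 + c * x))"
      unfolding \<phi>'[OF xR] using nz[OF xR] by (simp add: field_simps)
    have d: "?d \<noteq> 0"
      using sums[OF x] unfolding den by auto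
    have val: "?H x * ?\<phi> x / (?\<phi> x - x * deriv ?\<phi> x) = - ((x + 1) powr a * (c * x + 1) / ?d)"
    proof -
      have "h * p / (p * (- d / e)) = - (h * e / d)" if "p \<noteq> 0" "d \<noteq> 0" "e \<noteq> 0" for h p d e :: complex
        using that by (simp add: field_simps)
      from this[OF \<phi>x d nz[OF xR]] show ?thesis
        unfolding den by (simp only: add.commute[of x 1] add.commute[of "c * x" 1])
    qed
    have "(\<lambda>n. (deriv ^^ n) (\<lambda>t. ?H t * ?\<phi> t ^ n) 0 / fact n * (x / ?\<phi> x) ^ n) = summand a \<beta> c x"
      using summand_coeff_eq_deriv[OF R(1) nz]
      by (simp add: fun_eq_iff summand_def powr_minus divide_inverse add.commute[of "c * x" 1])
    with sums[OF x] val d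
    show "?d \<noteq> 0 \<and> summand a \<beta> c x sums (- ((x + 1) powr a * (c * x + 1) / ?d))"
      by simp
  qed
qed

section \<open>Continuation to connected domains of convergence\<close>

text \<open>An open subset of a closed ball lies in its interior. Convergence at a point only bounds
  its norm by the radius of convergence; this makes the bound strict.\<close>

lemma open_bounded_by_radius:
  fixes W :: "'a::euclidean_space set" and R :: ereal
  assumes "open W" "\<And>w. w \<in> W \<Longrightarrow> norm w \<le> R" "w \<in> W"
  shows "norm w < R"
proof (cases R)
  case (real r)
  have "W \<subseteq> interior (cball 0 r)"
    using assms real by (intro interior_maximal) auto
  with assms(3) real show ?thesis by auto
qed (use assms(2,3) in auto)

theorem proposition3p4:
  fixes a \<beta> c :: complex
  shows "(\<exists>r>0. \<forall>x. norm x < r \<longrightarrow>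
            \<beta> * c * x - c * x - 1 \<noteq> 0 \<and>
            summand a \<beta> c x sums
              (- ((x + 1) powr a * (c * x + 1) / (\<beta> * c * x - c * x - 1))))
       \<and> (\<forall>U. open U \<longrightarrow> connected U \<longrightarrow> 0 \<in> U \<longrightarrow>
            (\<forall>x\<in>U. x + 1 \<notin> \<real>\<^sub>\<le>\<^sub>0 \<and> c * x + 1 \<notin> \<real>\<^sub>\<le>\<^sub>0 \<and> summable (summand a \<beta> c x)) \<longrightarrow>
            (\<forall>x\<in>U. \<beta> * c * x - c * x - 1 \<noteq> 0 \<and>
              summand a \<beta> c x sums
                (- ((x + 1) powr a * (c * x + 1) / (\<beta> * c * x - c * x - 1)))))"
proof -
  let ?d = "\<lambda>x. \<beta> * c * x - c * x - 1"
  let ?v = "\<lambda>x. (x + 1) powr a * (c * x + 1)"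
  obtain r where r: "r > 0"
    and near: "\<And>x. norm x < r \<Longrightarrow> ?d x \<noteq> 0 \<and> summand a \<beta> c x sums (- (?v x / ?d x))"
    using summand_sums_near_0 by metis
  have extend: "?d x \<noteq> 0 \<and> summand a \<beta> c x sums (- (?v x / ?d x))"
    if U: "open U" "connected U" "0 \<in> U"
      and slit: "\<And>x. x \<in> U \<Longrightarrow> x + 1 \<notin> \<real>\<^sub>\<le>\<^sub>0" "\<And>x. x \<in> U \<Longrightarrow> c * x + 1 \<notin> \<real>\<^sub>\<le>\<^sub>0"
      and summ: "\<And>x. x \<in> U \<Longrightarrow> summable (summand a \<beta> c x)" and x: "x \<in> U" for U x
  proof -
    \<comment> \<open>The summand depends on x only through g(x): the series is the power series F
      evaluated there.\<close>
    define g where "g = (\<lambda>x. x * (c * x + 1) powr (- \<beta>))"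
    define F where "F = Abs_fps (summand_coeff a \<beta> c)"
    have summand_eq: "summand a \<beta> c x = (\<lambda>n. fps_nth F n * g x ^ n)" for x
      by (simp add: fun_eq_iff summand_def F_def g_def)
    have hol_g: "g holomorphic_on U"
      unfolding g_def by (intro holomorphic_intros slit)
    have nonzero: "y + 1 \<noteq> 0" "c * y + 1 \<noteq> 0" if "y \<in> U" for y
      using slit[OF that] by auto
    \<comment> \<open>Required by the open mapping theorem: g(0) = 0, but g is nonzero at a small
      positive real point.\<close>
    have "\<not> g constant_on U"
    proof
      assume const: "g constant_on U"
      obtain e where e: "e > 0" "ball 0 e \<subseteq> U"
        using U by (auto simp: open_contains_ball)
      hence "of_real (e / 2) \<in> U" by auto
      moreover from this have "g (of_real (e / 2)) \<noteq> 0"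
        using nonzero(2)[of "of_real (e / 2)"] e(1) by (simp add: g_def powr_def)
      ultimately show False
        using const U(3) unfolding constant_on_def by (metis g_def mult_zero_left)
    qed
    hence "open (g ` U)"
      using U hol_g by (intro open_mapping_thm[where S = U]) auto
    moreover have "norm w \<le> fps_conv_radius F" if "w \<in> g ` U" for w
      using that summ unfolding fps_conv_radius_def by (auto intro!: conv_radius_geI simp: summand_eq)
    ultimately have in_disc: "norm (g y) < fps_conv_radius F" if "y \<in> U" for y
      using open_bounded_by_radius[of "g ` U"] that by blast
    have sums_F: "summand a \<beta> c y sums eval_fps F (g y)" if "y \<in> U" for y
      using summable_fps[OF in_disc[OF that]] by (simp add: summand_eq eval_fps_def summable_sums)
    have hol_F: "(\<lambda>y. eval_fps F (g y)) holomorphic_on U"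
      using holomorphic_on_compose[OF hol_g holomorphic_on_eval_fps[of "g ` U" F]] in_disc
      by (simp add: o_def image_subset_iff)
    \<comment> \<open>Without division both sides are holomorphic on all of U, possible zeros of the
      denominator included.\<close>
    have id: "eval_fps F (g x) * ?d x = - ?v x"
    proof (rule analytic_continuation_open[of "U \<inter> ball 0 r" U
             "\<lambda>y. eval_fps F (g y) * ?d y" "\<lambda>y. - ?v y"])
      show "U \<inter> ball 0 r \<noteq> {}" using U(3) r by auto
      show "(\<lambda>y. eval_fps F (g y) * ?d y) holomorphic_on U"
        by (intro holomorphic_intros hol_F)
      show "(\<lambda>y. - ?v y) holomorphic_on U"
        by (intro holomorphic_intros slit)
      fix y assume y: "y \<in> U \<inter> ball 0 r"
      hence "?d y \<noteq> 0" "eval_fps F (g y) = - (?v y / ?d y)"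
        using near[of y] sums_F[of y] sums_unique2 by auto
      thus "eval_fps F (g y) * ?d y = - ?v y" by simp
    qed (use U x in auto)
    have "?v x \<noteq> 0"
      using nonzero[OF x] by (simp add: powr_def)
    hence d: "?d x \<noteq> 0"
      using id by auto
    hence "eval_fps F (g x) = - (?v x / ?d x)"
      using id by (simp add: field_simps)
    with d sums_F[OF x] show ?thesis by simp
  qed
  show ?thesis
  proof (rule conjI)
    show "\<exists>r>0. \<forall>x. norm x < r \<longrightarrow> ?d x \<noteq> 0 \<and> summand a \<beta> c x sums (- (?v x / ?d x))"
      using r near by (intro exI[of _ r] conjI[OF r] allI impI)
    show "\<forall>U. open U \<longrightarrow> connected U \<longrightarrow> 0 \<in> U \<longrightarrow>
            (\<forall>x\<in>U. x + 1 \<notin> \<real>\<^sub>\<le>\<^sub>0 \<and> c * x + 1 \<notin> \<real>\<^sub>\<le>\<^sub>0 \<and> summable (summand a \<beta> c x)) \<longrightarrow>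
            (\<forall>x\<in>U. ?d x \<noteq> 0 \<and> summand a \<beta> c x sums (- (?v x / ?d x)))"
      by (intro allI impI ballI extend) blast+
  qed
qed

end
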